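(* Let $E$ be a finite set, let $\mathfrak A$ be a finite family of subsets of $E$, and let $I\subseteq E$. Suppose that the map $A\mapsto A\setminus I$ is injective on $\mathfrak A$. Then for all nonnegative reals $(q_e)_{e\in E}$, $$\sum_{A\in\mathfrak A}\prod_{e\in A\setminus I}q_e\le\prod_{e\in E\setminus I}(1+q_e).$$
   Context: Empty products equal $1$. *)

theory Defs
  imports Complex_Main
begin

end

theory Submission
  imports Defs
begin

text \<open>The right-hand side expands to the sum of \<open>\<Prod>e\<in>X. q e\<close> over all \<open>X \<subseteq> E - I\<close>; by injectivity the left-hand
side collects some of these nonnegative terms, each at most once.\<close>

theorem lemma9p3:
  fixes E I :: "'a set" and \<AA> :: "'a set set" and q :: "'a \<Rightarrow> real"
  assumes "finite E"
    and "finite \<AA>"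
    and "\<And>A. A \<in> \<AA> \<Longrightarrow> A \<subseteq> E"
    and "I \<subseteq> E"
    and "inj_on (\<lambda>A. A - I) \<AA>"
    and "\<And>e. e \<in> E \<Longrightarrow> 0 \<le> q e"
  shows "(\<Sum>A\<in>\<AA>. \<Prod>e\<in>A - I. q e) \<le> (\<Prod>e\<in>E - I. 1 + q e)"
proof -
  have "(\<Sum>A\<in>\<AA>. \<Prod>e\<in>A - I. q e) = (\<Sum>X\<in>(\<lambda>A. A - I) ` \<AA>. prod q X)"
    using assms(5) by (simp add: sum.reindex)
  \<comment> \<open>Each \<open>A - I\<close> lies in \<open>E - I\<close>, so only the subsets not
    of this form are added; their terms are products of values of \<open>q\<close> on
    \<open>E\<close>, hence nonnegative.\<close>
  also have "\<dots> \<le> (\<Sum>X\<in>Pow (E - I). prod q X)"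
    using assms(1,3,6) by (intro sum_mono2 prod_nonneg) auto
  \<comment> \<open>With \<open>q e\<close> as the first summand, \<open>X\<close> is the set of
    factors contributing \<open>q e\<close>; the factors outside \<open>X\<close> contribute
    \<open>1\<close>, so the term is \<open>prod q X\<close> without passing to complements.\<close>
  also have "\<dots> = (\<Prod>e\<in>E - I. q e + 1)"
    using assms(1) by (subst prod_add) simp_all
  finally show ?thesis
    by (simp add: add.commute)
qed

end
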